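(* Let $\mathfrak{g}$ be a finite dimensional Lie algebra over $\mathbb{C}$ with dual bases $X_1,\dots,X_N$ of $\mathfrak{g}$ and $\theta^1,\dots,\theta^N$ of $\mathfrak{g}^*$. Let $V$ be a vector space with a right $\mathfrak{g}$-action $v\cdot X$, and with a right $S(\mathfrak{g}^* )$-action $v\lhd\theta$ and a left $\mathfrak{g}$-coaction $v\mapsto v_{[-1]}\otimes v_{[0]}$ that correspond to each other by $v\lhd\theta=\theta(v_{[-1]})v_{[0]}$ for $\theta\in\mathfrak{g}^*$. Then $V$ is a stable right $\widetilde{\mathfrak{g}}$-module if and only if it is a right-left SAYD module over $\mathfrak{g}$.
   Context: $\widetilde{\mathfrak{g}}=\mathfrak{g}^*\rtimes\mathfrak{g}$ is $\mathfrak{g}^*\oplus\mathfrak{g}$ with bracket $[\alpha\oplus X,\beta\oplus Y]=(\mathcal{L}_X\beta-\mathcal{L}_Y\alpha)\oplus[X,Y]$, where $\mathcal{L}_X\beta=X\rhd\beta$ is the coadjoint action, $X_j\rhd\theta^t=-\sum_kC^t_{jk}\theta^k$ with $[X_j,X_k]=\sum_tC^t_{jk}X_t$. $V$ (with the two actions) is a right $\widetilde{\mathfrak{g}}$-module iff $(v\cdot X_j)\lhd\theta^t=v\lhd(X_j\rhd\theta^t)+(v\lhd\theta^t)\cdot X_j$ for all $v,j,t$; it is stable if $\sum_i(v\lhd\theta^i)\cdot X_i=0$ for all $v\in V$. A left $\mathfrak{g}$-coaction is a linear map $\nabla_{\mathfrak{g}}:V\to\mathfrak{g}\otimes V$, $v\mapsto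 v_{[-1]}\otimes v_{[0]}$ (summation suppressed), with $v_{[-2]}\wedge v_{[-1]}\otimes v_{[0]}=0$, where $v_{[-2]}\otimes v_{[-1]}\otimes v_{[0]}=v_{[-1]}\otimes\nabla_{\mathfrak{g}}(v_{[0]})$. Right $S(\mathfrak{g}^* )$-module structures and left $\mathfrak{g}$-comodule structures on $V$ correspond via $v\lhd\theta=\theta(v_{[-1]})v_{[0]}$. $V$ is right-left SAYD (stable-anti-Yetter-Drinfeld) over $\mathfrak{g}$ if $\nabla_{\mathfrak{g}}(v\cdot X)=v_{[-1]}\otimes v_{[0]}\cdot X+[v_{[-1]},X]\otimes v_{[0]}$ and $v_{[0]}\cdot v_{[-1]}=0$ for all $v\in V$, $X\in\mathfrak{g}$. *)

theory Defs
  imports Complex_Main "HOL-Library.Poly_Mapping" "HOL-Library.Product_Plus"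
begin

section \<open>Complex vector spaces\<close>

class complex_vector = ab_group_add +
  fixes scaleC :: "complex \<Rightarrow> 'a \<Rightarrow> 'a" (infixr "*\<^sub>C" 75)
  assumes scaleC_add_right: "a *\<^sub>C (x + y) = a *\<^sub>C x + a *\<^sub>C y"
    and scaleC_add_left: "(a + b) *\<^sub>C x = a *\<^sub>C x + b *\<^sub>C x"
    and scaleC_scaleC: "a *\<^sub>C (b *\<^sub>C x) = (a * b) *\<^sub>C x"
    and scaleC_one: "1 *\<^sub>C x = x"

global_interpretation cvec: vector_space "scaleC :: complex \<Rightarrow> 'a \<Rightarrow> 'a::complex_vector"
  by unfold_locales (rule scaleC_add_right scaleC_add_left scaleC_scaleC scaleC_one)+

abbreviation clinear :: "('a::complex_vector \<Rightarrow> 'b::complex_vector) \<Rightarrow> bool" where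
  "clinear \<equiv> Vector_Spaces.linear scaleC scaleC"

definition cbilinear ::
  "('a::complex_vector \<Rightarrow> 'b::complex_vector \<Rightarrow> 'c::complex_vector) \<Rightarrow> bool" where
  "cbilinear B \<longleftrightarrow> (\<forall>x. clinear (B x)) \<and> (\<forall>y. clinear (\<lambda>x. B x y))"

lemma clinear_iff:
  "clinear f \<longleftrightarrow> (\<forall>x y. f (x + y) = f x + f y) \<and> (\<forall>c x. f (c *\<^sub>C x) = c *\<^sub>C f x)"
  by (simp add: Vector_Spaces.linear_iff cvec.vector_space_axioms)

lemma clinear_add: "clinear f \<Longrightarrow> f (x + y) = f x + f y"
  and clinear_scale: "clinear f \<Longrightarrow> f (c *\<^sub>C x) = c *\<^sub>C f x"
  by (simp_all add: clinear_iff)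

lemma clinear_0: "clinear f \<Longrightarrow> f 0 = 0"
  using clinear_scale[of f 0 0] by simp

lemma clinear_minus: "clinear f \<Longrightarrow> f (- x) = - f x"
  using clinear_add[of f "- x" x] by (simp add: clinear_0 eq_neg_iff_add_eq_0)

lemma clinear_diff: "clinear f \<Longrightarrow> f (x - y) = f x - f y"
  using clinear_add[of f x "- y"] by (simp add: clinear_minus)

lemma clinear_sum: "clinear f \<Longrightarrow> f (sum g A) = (\<Sum>i\<in>A. f (g i))"
  by (induction A rule: infinite_finite_induct) (auto simp: clinear_0 clinear_add)

lemma cbilinear_iff:
  "cbilinear B \<longleftrightarrow>
    (\<forall>x y z. B (x + y) z = B x z + B y z) \<and> (\<forall>x y z. B x (y + z) = B x y + B x z) \<and>
    (\<forall>c x y. B (c *\<^sub>C x) y = c *\<^sub>C B x y) \<and> (\<forall>c x y. B x (c *\<^sub>C y) = c *\<^sub>C B x y)"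
  unfolding cbilinear_def clinear_iff by blast

instantiation complex :: complex_vector
begin
definition scaleC_complex :: "complex \<Rightarrow> complex \<Rightarrow> complex" where
  "scaleC_complex = (*)"
instance by standard (simp_all add: scaleC_complex_def algebra_simps)
end

instantiation prod :: (complex_vector, complex_vector) complex_vector
begin
definition scaleC_prod :: "complex \<Rightarrow> 'a \<times> 'b \<Rightarrow> 'a \<times> 'b" where
  "scaleC_prod c p = (c *\<^sub>C fst p, c *\<^sub>C snd p)"
instance
  by standard
    (simp_all add: scaleC_prod_def prod_eq_iff scaleC_add_right scaleC_add_left)
end

instantiation poly_mapping :: (type, complex_vector) complex_vector
begin
lift_definition scaleC_poly_mapping :: "complex \<Rightarrow> ('a \<Rightarrow>\<^sub>0 'b) \<Rightarrow> ('a \<Rightarrow>\<^sub>0 'b)" is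
  "\<lambda>c f k. c *\<^sub>C f k"
  by (erule rev_finite_subset) auto
instance
  by standard (transfer; simp add: scaleC_add_right scaleC_add_left)+
end


lemma clinear_complex_iff:
  "clinear f \<longleftrightarrow> (\<forall>x y. f (x + y) = f x + f y) \<and> (\<forall>c x. f (c *\<^sub>C x) = c * f x)"
  for f :: "'a::complex_vector \<Rightarrow> complex"
  by (subst clinear_iff) (simp add: scaleC_complex_def)


section \<open>The dual space\<close>

typedef (overloaded) ('a::complex_vector) dual = "{f :: 'a \<Rightarrow> complex. clinear f}"
  morphisms dual_apply Abs_dual
  by (rule exI[of _ "\<lambda>_. 0"]) (simp add: clinear_iff)

setup_lifting type_definition_dual

instantiation dual :: (complex_vector) complex_vector
begin
lift_definition zero_dual :: "'a dual" is "\<lambda>_. 0" by (simp add: clinear_complex_iff)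
lift_definition plus_dual :: "'a dual \<Rightarrow> 'a dual \<Rightarrow> 'a dual" is "\<lambda>f g x. f x + g x"
  by (simp add: clinear_complex_iff algebra_simps)
lift_definition uminus_dual :: "'a dual \<Rightarrow> 'a dual" is "\<lambda>f x. - f x"
  by (simp add: clinear_complex_iff)
lift_definition minus_dual :: "'a dual \<Rightarrow> 'a dual \<Rightarrow> 'a dual" is "\<lambda>f g x. f x - g x"
  by (simp add: clinear_complex_iff algebra_simps)
lift_definition scaleC_dual :: "complex \<Rightarrow> 'a dual \<Rightarrow> 'a dual" is "\<lambda>c f x. c * f x"
  by (simp add: clinear_complex_iff algebra_simps)
instance by standard (transfer; simp add: algebra_simps)+
end

lemma dual_eqI: "(\<And>x. dual_apply f x = dual_apply g x) \<Longrightarrow> f = g"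
  by transfer auto

lemma clinear_dual_apply: "clinear (dual_apply f)"
  by transfer simp

lemmas dual_apply_simps =
  plus_dual.rep_eq uminus_dual.rep_eq minus_dual.rep_eq scaleC_dual.rep_eq zero_dual.rep_eq


section \<open>The tensor product\<close>

text \<open>The free vector space on the set of pairs, modulo the bilinearity relations.\<close>

definition tensor_relations ::
  "(('a::complex_vector \<times> 'b::complex_vector) \<Rightarrow>\<^sub>0 complex) set" where
  "tensor_relations =
    {Poly_Mapping.single (x + x', y) 1 - Poly_Mapping.single (x, y) 1
      - Poly_Mapping.single (x', y) 1 | x x' y. True} \<union>
    {Poly_Mapping.single (x, y + y') 1 - Poly_Mapping.single (x, y) 1
      - Poly_Mapping.single (x, y') 1 | x y y'. True} \<union>
    {Poly_Mapping.single (c *\<^sub>C x, y) 1 - c *\<^sub>C Poly_Mapping.single (x, y) 1 | c x y. True} \<union>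
    {Poly_Mapping.single (x, c *\<^sub>C y) 1 - c *\<^sub>C Poly_Mapping.single (x, y) 1 | c x y. True}"

definition tensor_rel ::
  "(('a::complex_vector \<times> 'b::complex_vector) \<Rightarrow>\<^sub>0 complex) \<Rightarrow> ('a \<times> 'b \<Rightarrow>\<^sub>0 complex) \<Rightarrow> bool" where
  "tensor_rel f g \<longleftrightarrow> f - g \<in> cvec.span tensor_relations"

lemma equivp_mod_subspace:
  assumes "cvec.subspace S"
  shows "equivp (\<lambda>f g. f - g \<in> S)"
proof (rule equivpI)
  show "reflp (\<lambda>f g. f - g \<in> S)"
    using cvec.subspace_0[OF assms] by (simp add: reflp_def)
  show "symp (\<lambda>f g. f - g \<in> S)"
    by (rule sympI, drule cvec.subspace_neg[OF assms]) simp
  show "transp (\<lambda>f g. f - g \<in> S)"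
  proof (rule transpI)
    fix f g h assume "f - g \<in> S" "g - h \<in> S"
    then have "(f - g) + (g - h) \<in> S" by (rule cvec.subspace_add[OF assms])
    then show "f - h \<in> S" by simp
  qed
qed

quotient_type (overloaded) ('a, 'b) tensor =
  "('a::complex_vector \<times> 'b::complex_vector) \<Rightarrow>\<^sub>0 complex" / tensor_rel
  unfolding tensor_rel_def[abs_def] by (rule equivp_mod_subspace) simp

lemma diff_in_span_add:
  "f - g \<in> cvec.span S \<Longrightarrow> f' - g' \<in> cvec.span S \<Longrightarrow> (f + f') - (g + g') \<in> cvec.span S"
  using cvec.span_add[of "f - g" S "f' - g'"] by (simp add: algebra_simps)

lemma diff_in_span_minus:
  "f - g \<in> cvec.span S \<Longrightarrow> f' - g' \<in> cvec.span S \<Longrightarrow> (f - f') - (g - g') \<in> cvec.span S"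
  using cvec.span_diff[of "f - g" S "f' - g'"] by (simp add: algebra_simps)

lemma diff_in_span_uminus: "f - g \<in> cvec.span S \<Longrightarrow> - f - - g \<in> cvec.span S"
  using cvec.span_neg[of "f - g" S] by (simp add: algebra_simps)

lemma diff_in_span_scale: "f - g \<in> cvec.span S \<Longrightarrow> c *\<^sub>C f - c *\<^sub>C g \<in> cvec.span S"
  using cvec.span_scale[of "f - g" S c] by (simp add: cvec.scale_right_diff_distrib)

instantiation tensor :: (complex_vector, complex_vector) complex_vector
begin
lift_definition zero_tensor :: "('a, 'b) tensor" is 0 .
lift_definition plus_tensor :: "('a, 'b) tensor \<Rightarrow> ('a, 'b) tensor \<Rightarrow> ('a, 'b) tensor" is "(+)"
  unfolding tensor_rel_def by (rule diff_in_span_add)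
lift_definition uminus_tensor :: "('a, 'b) tensor \<Rightarrow> ('a, 'b) tensor" is "uminus"
  unfolding tensor_rel_def by (rule diff_in_span_uminus)
lift_definition minus_tensor :: "('a, 'b) tensor \<Rightarrow> ('a, 'b) tensor \<Rightarrow> ('a, 'b) tensor" is "(-)"
  unfolding tensor_rel_def by (rule diff_in_span_minus)
lift_definition scaleC_tensor :: "complex \<Rightarrow> ('a, 'b) tensor \<Rightarrow> ('a, 'b) tensor" is "scaleC"
  unfolding tensor_rel_def by (rule diff_in_span_scale)
instance
  by standard
    (transfer; simp add: tensor_rel_def cvec.span_zero scaleC_add_right scaleC_add_left algebra_simps)+
end

lift_definition tensor :: "'a::complex_vector \<Rightarrow> 'b::complex_vector \<Rightarrow> ('a, 'b) tensor"
  (infixr "\<otimes>" 76) is "\<lambda>x y. Poly_Mapping.single (x, y) 1" .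

lemma cbilinear_tensor: "cbilinear (\<otimes>)"
  unfolding cbilinear_iff
proof (intro conjI allI)
  fix x x' :: 'a and y y' :: 'b and c :: complex
  show "(x + x') \<otimes> y = x \<otimes> y + x' \<otimes> y"
    by transfer (unfold tensor_rel_def diff_diff_eq[symmetric], rule cvec.span_base,
      unfold tensor_relations_def, blast)
  show "x \<otimes> (y + y') = x \<otimes> y + x \<otimes> y'"
    by transfer (unfold tensor_rel_def diff_diff_eq[symmetric], rule cvec.span_base,
      unfold tensor_relations_def, blast)
  show "(c *\<^sub>C x) \<otimes> y = c *\<^sub>C (x \<otimes> y)"
    by transfer (unfold tensor_rel_def, rule cvec.span_base, unfold tensor_relations_def, blast)
  show "x \<otimes> (c *\<^sub>C y) = c *\<^sub>C (x \<otimes> y)"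
    by transfer (unfold tensor_rel_def, rule cvec.span_base, unfold tensor_relations_def, blast)
qed

definition free_extension ::
  "('a \<Rightarrow> 'b \<Rightarrow> 'c::complex_vector) \<Rightarrow> (('a \<times> 'b) \<Rightarrow>\<^sub>0 complex) \<Rightarrow> 'c" where
  "free_extension B f =
    (\<Sum>p\<in>Poly_Mapping.keys f. Poly_Mapping.lookup f p *\<^sub>C B (fst p) (snd p))"

text \<open>
  The linear map induced on the tensor product by a bilinear map \<open>B\<close>; for bilinear \<open>B\<close> the value
  does not depend on the chosen representative. For a tensor written in Sweedler style as
  \<open>t = a \<otimes> b\<close> (summation suppressed), \<open>tensor_lift (\<lambda>a b. B a b) t\<close> is \<open>B a b\<close>.
\<close>

definition tensor_lift ::
  "('a::complex_vector \<Rightarrow> 'b::complex_vector \<Rightarrow> 'c::complex_vector) \<Rightarrow> ('a, 'b) tensor \<Rightarrow> 'c" where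
  "tensor_lift B t = free_extension B (rep_tensor t)"

lemma free_extension_single: "free_extension B (Poly_Mapping.single (x, y) 1) = B x y"
  by (simp add: free_extension_def scaleC_one)

lemma clinear_free_extension: "clinear (free_extension B)"
  unfolding clinear_iff
proof (intro conjI allI)
  fix f g :: "'a \<times> 'b \<Rightarrow>\<^sub>0 complex" and c
  show "free_extension B (f + g) = free_extension B f + free_extension B g"
    unfolding free_extension_def
    by (rule setsum_keys_plus_distrib) (simp_all add: scaleC_add_left)
  show "free_extension B (c *\<^sub>C f) = c *\<^sub>C free_extension B f"
  proof (cases "c = 0")
    case True
    then show ?thesis by (simp add: free_extension_def)
  next
    case False
    have l: "Poly_Mapping.lookup (c *\<^sub>C f) p = c * Poly_Mapping.lookup f p" for p
      by transfer (simp add: scaleC_complex_def)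
    from False have "Poly_Mapping.keys (c *\<^sub>C f) = Poly_Mapping.keys f"
      by (auto simp: in_keys_iff l)
    then show ?thesis
      by (simp add: free_extension_def l cvec.scale_sum_right)
  qed
qed

lemma free_extension_cong:
  assumes B: "cbilinear B" and fg: "tensor_rel f g"
  shows "free_extension B f = free_extension B g"
proof -
  note lin = clinear_free_extension[of B]
  have sub: "cvec.subspace {f. free_extension B f = 0}"
    unfolding cvec.subspace_def using lin
    by (auto simp: clinear_0 clinear_add clinear_scale)
  have "tensor_relations \<subseteq> {f. free_extension B f = 0}"
    using B unfolding tensor_relations_def cbilinear_iff
    by (auto simp: clinear_diff[OF lin] clinear_scale[OF lin] free_extension_single)
  from cvec.span_minimal[OF this sub] fg have "free_extension B (f - g) = 0"
    unfolding tensor_rel_def by auto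
  then show ?thesis by (simp add: clinear_diff[OF lin])
qed

lemma tensor_lift_abs:
  assumes "cbilinear B"
  shows "tensor_lift B (abs_tensor f) = free_extension B f"
  unfolding tensor_lift_def
  by (rule free_extension_cong[OF assms], rule Quotient3_rep_abs[OF Quotient3_tensor],
      rule equivp_reflp[OF tensor_equivp])

lemma tensor_lift_tensor: "cbilinear B \<Longrightarrow> tensor_lift B (x \<otimes> y) = B x y"
  by (simp add: tensor.abs_eq tensor_lift_abs free_extension_single)

lemma clinear_tensor_lift:
  assumes B: "cbilinear B"
  shows "clinear (tensor_lift B)"
  unfolding clinear_iff
proof (intro conjI allI)
  note lin = clinear_free_extension[of B]
  fix s t :: "('a, 'b) tensor" and c
  show "tensor_lift B (s + t) = tensor_lift B s + tensor_lift B t"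
    by (induction s; induction t)
      (simp add: plus_tensor.abs_eq tensor_lift_abs[OF B] clinear_add[OF lin])
  show "tensor_lift B (c *\<^sub>C t) = c *\<^sub>C tensor_lift B t"
    by (induction t)
      (simp add: scaleC_tensor.abs_eq tensor_lift_abs[OF B] clinear_scale[OF lin])
qed

lemma tensor_induct [case_names add scale tensor]:
  assumes add: "\<And>s t. P s \<Longrightarrow> P t \<Longrightarrow> P (s + t)"
    and scale: "\<And>c t. P t \<Longrightarrow> P (c *\<^sub>C t)"
    and tensor: "\<And>x y. P (x \<otimes> y)"
  shows "P t"
proof -
  have single: "P (abs_tensor (Poly_Mapping.single k v))" for k v
  proof -
    have "v *\<^sub>C Poly_Mapping.single k 1 = Poly_Mapping.single k v"
      by transfer (auto simp: scaleC_complex_def when_def fun_eq_iff)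
    then have "abs_tensor (Poly_Mapping.single k v) = v *\<^sub>C (fst k \<otimes> snd k)"
      by (simp add: tensor.abs_eq scaleC_tensor.abs_eq)
    then show ?thesis using scale tensor by simp
  qed
  have "P (abs_tensor f)" for f
  proof (induction "card (Poly_Mapping.keys f)" arbitrary: f)
    case 0
    then have "f = Poly_Mapping.single undefined 0" by simp
    then show ?case using single by metis
  next
    case (Suc n)
    then obtain k where k: "k \<in> Poly_Mapping.keys f" by (metis card.empty ex_in_conv nat.distinct(1))
    define s where "s = Poly_Mapping.single k (Poly_Mapping.lookup f k)"
    have "Poly_Mapping.keys (f - s) = Poly_Mapping.keys f - {k}"
      by (auto simp: in_keys_iff s_def lookup_minus lookup_single when_def split: if_splits)
    then have "n = card (Poly_Mapping.keys (f - s))" using Suc.hyps(2) k by simp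
    then have "P (abs_tensor (f - s))" by (rule Suc.hyps(1))
    then have "P (abs_tensor (f - s) + abs_tensor s)" using single add unfolding s_def by blast
    then show ?case by (simp add: plus_tensor.abs_eq)
  qed
  then show ?thesis by (metis Quotient3_abs_rep[OF Quotient3_tensor])
qed


section \<open>The exterior square\<close>

quotient_type (overloaded) 'a ext_square = "('a::complex_vector, 'a) tensor" /
  "\<lambda>s t. s - t \<in> cvec.span {x \<otimes> x | x. True}"
  by (rule equivp_mod_subspace) simp

instantiation ext_square :: (complex_vector) complex_vector
begin
lift_definition zero_ext_square :: "'a ext_square" is 0 .
lift_definition plus_ext_square :: "'a ext_square \<Rightarrow> 'a ext_square \<Rightarrow> 'a ext_square" is "(+)"
  by (rule diff_in_span_add)
lift_definition uminus_ext_square :: "'a ext_square \<Rightarrow> 'a ext_square" is "uminus"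
  by (rule diff_in_span_uminus)
lift_definition minus_ext_square :: "'a ext_square \<Rightarrow> 'a ext_square \<Rightarrow> 'a ext_square" is "(-)"
  by (rule diff_in_span_minus)
lift_definition scaleC_ext_square :: "complex \<Rightarrow> 'a ext_square \<Rightarrow> 'a ext_square" is "scaleC"
  by (rule diff_in_span_scale)
instance
  by standard
    (transfer; simp add: cvec.span_zero scaleC_add_right scaleC_add_left algebra_simps)+
end

lift_definition wedge :: "'a::complex_vector \<Rightarrow> 'a \<Rightarrow> 'a ext_square" (infixr "\<and>\<^sub>e" 77)
  is "\<lambda>x y. x \<otimes> y" .

lemma cbilinear_wedge: "cbilinear (\<and>\<^sub>e)"
  unfolding cbilinear_iff
proof (intro conjI allI)
  note bil = cbilinear_tensor[unfolded cbilinear_iff, rule_format]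
  fix x y z :: 'a and c
  show "(x + y) \<and>\<^sub>e z = x \<and>\<^sub>e z + y \<and>\<^sub>e z" by transfer (simp add: bil cvec.span_zero)
  show "x \<and>\<^sub>e (y + z) = x \<and>\<^sub>e y + x \<and>\<^sub>e z" by transfer (simp add: bil cvec.span_zero)
  show "(c *\<^sub>C x) \<and>\<^sub>e y = c *\<^sub>C (x \<and>\<^sub>e y)" by transfer (simp add: bil cvec.span_zero)
  show "x \<and>\<^sub>e (c *\<^sub>C y) = c *\<^sub>C (x \<and>\<^sub>e y)" by transfer (simp add: bil cvec.span_zero)
qed

lemma wedge_self: "x \<and>\<^sub>e x = 0"
  by transfer (auto intro: cvec.span_base)


section \<open>The symmetric algebra\<close>

text \<open>
  \<open>S(W)\<close> as the polynomial ring in one commuting indeterminate per vector of \<open>W\<close>, modulo the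
  ideal expressing that \<open>W \<rightarrow> S(W)\<close> is linear. The type \<open>('w \<Rightarrow>\<^sub>0 nat) \<Rightarrow>\<^sub>0 complex\<close> is that of
  polynomials in indeterminates indexed by \<open>'w\<close>. The ideal generated by a set is its span when the
  ring is regarded as a module over itself.
\<close>

type_synonym 'w polys = "('w \<Rightarrow>\<^sub>0 nat) \<Rightarrow>\<^sub>0 complex"

definition indet :: "'w \<Rightarrow> 'w polys" where
  "indet w = Poly_Mapping.single (Poly_Mapping.single w 1) 1"

definition constp :: "complex \<Rightarrow> 'w polys" where
  "constp c = Poly_Mapping.single 0 c"

lemma module_times: "module ((*) :: 'a::comm_ring_1 \<Rightarrow> 'a \<Rightarrow> 'a)"
  by unfold_locales (simp_all add: algebra_simps)

definition sym_ideal :: "'w::complex_vector polys set" where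
  "sym_ideal = module.span (*)
    ({indet (x + y) - indet x - indet y | x y. True} \<union>
     {indet (c *\<^sub>C x) - constp c * indet x | c x. True})"

definition sym_rel :: "'w::complex_vector polys \<Rightarrow> 'w polys \<Rightarrow> bool" where
  "sym_rel p q \<longleftrightarrow> p - q \<in> sym_ideal"

lemma sym_ideal_0: "0 \<in> sym_ideal"
  and sym_ideal_add: "p \<in> sym_ideal \<Longrightarrow> q \<in> sym_ideal \<Longrightarrow> p + q \<in> sym_ideal"
  and sym_ideal_diff: "p \<in> sym_ideal \<Longrightarrow> q \<in> sym_ideal \<Longrightarrow> p - q \<in> sym_ideal"
  and sym_ideal_neg: "p \<in> sym_ideal \<Longrightarrow> - p \<in> sym_ideal"
  and sym_ideal_mult: "p \<in> sym_ideal \<Longrightarrow> r * p \<in> sym_ideal"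
  unfolding sym_ideal_def
  by (simp_all add: module.span_zero[OF module_times] module.span_add[OF module_times]
      module.span_diff[OF module_times] module.span_neg[OF module_times]
      module.span_scale[OF module_times])

lemma const_coeff_mult:
  fixes p q :: "'w polys"
  shows "Poly_Mapping.lookup (p * q) 0 = Poly_Mapping.lookup p 0 * Poly_Mapping.lookup q 0"
proof -
  have eq: "(0 = l + k) = (l = 0 \<and> k = 0)" for l k :: "'w \<Rightarrow>\<^sub>0 nat"
    by transfer (auto simp: fun_eq_iff)
  have i: "Sum_any (\<lambda>k. Poly_Mapping.lookup q k when 0 = l + k) =
      (Poly_Mapping.lookup q 0 when l = 0)" for l
    by (cases "l = 0") (simp_all add: eq)
  have "Poly_Mapping.lookup (p * q) 0 =
      Sum_any (\<lambda>l. Poly_Mapping.lookup p l *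
        Sum_any (\<lambda>k. Poly_Mapping.lookup q k when 0 = l + k))"
    by (rule lookup_mult)
  also have "\<dots> = Sum_any (\<lambda>l. (Poly_Mapping.lookup p l * Poly_Mapping.lookup q 0) when l = 0)"
    by (simp only: i mult_when)
  finally show ?thesis by simp
qed

lemma const_coeff_sym_ideal:
  assumes "p \<in> sym_ideal"
  shows "Poly_Mapping.lookup p 0 = 0"
proof -
  have "Poly_Mapping.single w (1::nat) \<noteq> 0" for w :: 'a
    by (metis lookup_single_eq lookup_zero zero_neq_one)
  then have [simp]: "Poly_Mapping.lookup (indet w) 0 = 0" for w :: 'a
    by (simp add: indet_def lookup_single when_def)
  have sub: "module.subspace (*) {p :: 'a polys. Poly_Mapping.lookup p 0 = 0}"
    by (rule module.subspaceI[OF module_times]) (auto simp: lookup_add const_coeff_mult)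
  have "sym_ideal \<subseteq> {p :: 'a polys. Poly_Mapping.lookup p 0 = 0}"
    unfolding sym_ideal_def
    by (rule module.span_minimal[OF module_times _ sub]) (auto simp: lookup_minus const_coeff_mult)
  with assms show ?thesis by auto
qed

quotient_type (overloaded) 'w sym_alg = "'w::complex_vector polys" / sym_rel
proof (rule equivpI)
  show "reflp sym_rel" by (simp add: reflp_def sym_rel_def sym_ideal_0)
  show "symp sym_rel" unfolding sym_rel_def
    by (rule sympI, drule sym_ideal_neg) simp
  show "transp sym_rel" unfolding sym_rel_def
    by (rule transpI, drule (1) sym_ideal_add) simp
qed

instantiation sym_alg :: (complex_vector) comm_ring_1
begin
lift_definition zero_sym_alg :: "'a sym_alg" is 0 .
lift_definition one_sym_alg :: "'a sym_alg" is 1 .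
lift_definition plus_sym_alg :: "'a sym_alg \<Rightarrow> 'a sym_alg \<Rightarrow> 'a sym_alg" is "(+)"
  unfolding sym_rel_def by (drule (1) sym_ideal_add) (simp add: algebra_simps)
lift_definition uminus_sym_alg :: "'a sym_alg \<Rightarrow> 'a sym_alg" is "uminus"
  unfolding sym_rel_def by (drule sym_ideal_neg) (simp add: algebra_simps)
lift_definition minus_sym_alg :: "'a sym_alg \<Rightarrow> 'a sym_alg \<Rightarrow> 'a sym_alg" is "(-)"
  unfolding sym_rel_def by (drule (1) sym_ideal_diff) (simp add: algebra_simps)
lift_definition times_sym_alg :: "'a sym_alg \<Rightarrow> 'a sym_alg \<Rightarrow> 'a sym_alg" is "(*)"
  unfolding sym_rel_def
proof -
  fix p q r s :: "'a polys"
  assume "p - q \<in> sym_ideal" "r - s \<in> sym_ideal"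
  then have "r * (p - q) + q * (r - s) \<in> sym_ideal"
    by (intro sym_ideal_add sym_ideal_mult)
  then show "p * r - q * s \<in> sym_ideal" by (simp add: algebra_simps)
qed
instance
proof
  show "(0::'a sym_alg) \<noteq> 1"
  proof transfer
    show "\<not> sym_rel (0::'a polys) 1"
      unfolding sym_rel_def using const_coeff_sym_ideal[of "0 - 1 :: 'a polys"]
      by (auto simp: lookup_minus lookup_one)
  qed
qed (transfer; simp add: sym_rel_def sym_ideal_0 algebra_simps)+
end

instantiation sym_alg :: (complex_vector) complex_vector
begin
lift_definition scaleC_sym_alg :: "complex \<Rightarrow> 'a sym_alg \<Rightarrow> 'a sym_alg" is
  "\<lambda>c p. constp c * p"
  unfolding sym_rel_def by (drule sym_ideal_mult, simp add: right_diff_distrib)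
instance
  by standard
    (transfer; simp add: sym_rel_def sym_ideal_0 algebra_simps constp_def single_add mult_single
      flip: mult.assoc)+
end

lift_definition sym_incl :: "'w::complex_vector \<Rightarrow> 'w sym_alg" is indet .

lemma clinear_sym_incl: "clinear sym_incl"
  unfolding clinear_iff
proof (intro conjI allI)
  fix x y :: 'a and c
  show "sym_incl (x + y) = sym_incl x + sym_incl y"
    by transfer (auto simp: sym_rel_def sym_ideal_def diff_diff_eq[symmetric]
        intro!: module.span_base[OF module_times])
  show "sym_incl (c *\<^sub>C x) = c *\<^sub>C sym_incl x"
    by transfer (auto simp: sym_rel_def sym_ideal_def intro!: module.span_base[OF module_times])
qed

definition right_sym_module ::
  "('v::complex_vector \<Rightarrow> 'w::complex_vector sym_alg \<Rightarrow> 'v) \<Rightarrow> bool" where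
  "right_sym_module act \<longleftrightarrow>
    cbilinear act \<and> (\<forall>v. act v 1 = v) \<and> (\<forall>v s t. act v (s * t) = act (act v s) t)"


section \<open>Lie algebras, modules and comodules\<close>

definition lie_algebra :: "('g::complex_vector \<Rightarrow> 'g \<Rightarrow> 'g) \<Rightarrow> bool" where
  "lie_algebra br \<longleftrightarrow>
    cbilinear br \<and> (\<forall>x. br x x = 0) \<and>
    (\<forall>x y z. br x (br y z) + br y (br z x) + br z (br x y) = 0)"

definition right_lie_module ::
  "('g::complex_vector \<Rightarrow> 'g \<Rightarrow> 'g) \<Rightarrow> ('v::complex_vector \<Rightarrow> 'g \<Rightarrow> 'v) \<Rightarrow> bool" where
  "right_lie_module br act \<longleftrightarrow>
    cbilinear act \<and> (\<forall>v x y. act v (br x y) = act (act v x) y - act (act v y) x)"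

text \<open>
  The cocommutativity condition is \<open>v\<^bsub>[-2]\<^esub> \<and> v\<^bsub>[-1]\<^esub> \<otimes> v\<^bsub>[0]\<^esub> = 0\<close>, where
  \<open>v\<^bsub>[-2]\<^esub> \<otimes> v\<^bsub>[-1]\<^esub> \<otimes> v\<^bsub>[0]\<^esub>\<close> is the iterated coaction \<open>(id \<otimes> \<nabla>) (\<nabla> v)\<close>.
\<close>

definition iterated_coaction ::
  "('v::complex_vector \<Rightarrow> ('g::complex_vector, 'v) tensor) \<Rightarrow> 'v \<Rightarrow> ('g, ('g, 'v) tensor) tensor" where
  "iterated_coaction coact v = tensor_lift (\<lambda>x w. x \<otimes> coact w) (coact v)"

definition left_lie_coaction ::
  "('v::complex_vector \<Rightarrow> ('g::complex_vector, 'v) tensor) \<Rightarrow> bool" where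
  "left_lie_coaction coact \<longleftrightarrow>
    clinear coact \<and>
    (\<forall>v. tensor_lift (\<lambda>x. tensor_lift (\<lambda>y w. (x \<and>\<^sub>e y) \<otimes> w)) (iterated_coaction coact v) = 0)"

definition right_left_SAYD ::
  "('g::complex_vector \<Rightarrow> 'g \<Rightarrow> 'g) \<Rightarrow> ('v::complex_vector \<Rightarrow> 'g \<Rightarrow> 'v) \<Rightarrow>
    ('v \<Rightarrow> ('g, 'v) tensor) \<Rightarrow> bool" where
  "right_left_SAYD br act coact \<longleftrightarrow>
    right_lie_module br act \<and> left_lie_coaction coact \<and>
    (\<forall>v X. coact (act v X) =
      tensor_lift (\<lambda>y w. y \<otimes> act w X) (coact v) + tensor_lift (\<lambda>y w. br y X \<otimes> w) (coact v)) \<and>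
    (\<forall>v. tensor_lift (\<lambda>y w. act w y) (coact v) = 0)"


section \<open>The semidirect product with the dual\<close>

text \<open>
  The coadjoint action \<open>(X \<rhd> \<beta>)(Y) = - \<beta> [X, Y]\<close>; lemma \<open>coad_structure_constants\<close> below gives
  its expression in dual bases.
\<close>

definition coad :: "('g::complex_vector \<Rightarrow> 'g \<Rightarrow> 'g) \<Rightarrow> 'g \<Rightarrow> 'g dual \<Rightarrow> 'g dual" where
  "coad br X \<beta> = Abs_dual (\<lambda>Y. - dual_apply \<beta> (br X Y))"

definition semidirect_br ::
  "('g::complex_vector \<Rightarrow> 'g \<Rightarrow> 'g) \<Rightarrow> 'g dual \<times> 'g \<Rightarrow> 'g dual \<times> 'g \<Rightarrow> 'g dual \<times> 'g" where
  "semidirect_br br = (\<lambda>(\<alpha>, X) (\<beta>, Y). (coad br X \<beta> - coad br Y \<alpha>, br X Y))"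

lemma dual_apply_coad:
  "lie_algebra br \<Longrightarrow> dual_apply (coad br X \<beta>) Y = - dual_apply \<beta> (br X Y)"
  unfolding coad_def lie_algebra_def cbilinear_iff
  by (subst Abs_dual_inverse)
    (auto simp: clinear_iff clinear_add[OF clinear_dual_apply] clinear_scale[OF clinear_dual_apply])

lemma lie_algebra_anticomm:
  assumes "lie_algebra br"
  shows "br x y = - br y x"
proof -
  have "br (x + y) (x + y) = (br x x + br x y) + (br y x + br y y)"
    using assms unfolding lie_algebra_def cbilinear_iff by metis
  moreover have "br z z = 0" for z
    using assms unfolding lie_algebra_def by blast
  ultimately have "br x y + br y x = 0" by simp
  then show ?thesis by (simp add: eq_neg_iff_add_eq_0)
qed

lemma lie_algebra_semidirect_br:
  assumes "lie_algebra br"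
  shows "lie_algebra (semidirect_br br)"
proof -
  note bil = assms[unfolded lie_algebra_def cbilinear_iff]
  note lin = clinear_add[OF clinear_dual_apply] clinear_scale[OF clinear_dual_apply]
    clinear_minus[OF clinear_dual_apply] clinear_diff[OF clinear_dual_apply]
  have jac: "br (br x y) z = br x (br y z) - br y (br x z)" for x y z
  proof -
    have neg: "br y (- u) = - br y u" for y u
      using bil clinear_minus[of "br y" u] by (auto simp: clinear_iff)
    have "br x (br y z) + br y (br z x) + br z (br x y) = 0" using bil by blast
    moreover have "br z x = - br x z" "br z (br x y) = - br (br x y) z"
      by (rule lie_algebra_anticomm[OF assms])+
    ultimately show ?thesis by (simp add: neg algebra_simps eq_neg_iff_add_eq_0)
  qed
  have "cbilinear (semidirect_br br)"
    unfolding cbilinear_iff semidirect_br_def using bil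
    by (auto simp: scaleC_prod_def dual_apply_simps dual_apply_coad[OF assms] lin
        scaleC_complex_def algebra_simps intro!: dual_eqI)
  moreover have "semidirect_br br p p = 0" for p
    using bil by (cases p) (simp add: semidirect_br_def zero_prod_def)
  moreover have "semidirect_br br p (semidirect_br br q r) + semidirect_br br q (semidirect_br br r p)
      + semidirect_br br r (semidirect_br br p q) = 0" for p q r
    using bil
    by (cases p; cases q; cases r)
      (auto simp: semidirect_br_def zero_prod_def dual_apply_simps dual_apply_coad[OF assms] lin jac
        intro!: dual_eqI)
  ultimately show ?thesis unfolding lie_algebra_def by blast
qed


section \<open>Dual bases\<close>

definition is_basis :: "nat \<Rightarrow> (nat \<Rightarrow> 'a::complex_vector) \<Rightarrow> bool" where
  "is_basis N e \<longleftrightarrow>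
    inj_on e {1..N} \<and> cvec.independent (e ` {1..N}) \<and> cvec.span (e ` {1..N}) = UNIV"

definition dual_bases ::
  "nat \<Rightarrow> (nat \<Rightarrow> 'g::complex_vector) \<Rightarrow> (nat \<Rightarrow> 'g dual) \<Rightarrow> bool" where
  "dual_bases N X \<theta> \<longleftrightarrow>
    is_basis N X \<and> is_basis N \<theta> \<and>
    (\<forall>i\<in>{1..N}. \<forall>j\<in>{1..N}. dual_apply (\<theta> i) (X j) = (if i = j then 1 else 0))"

lemma dual_basis_expansion:
  assumes "dual_bases N X \<theta>"
  shows "\<beta> = (\<Sum>k=1..N. dual_apply \<beta> (X k) *\<^sub>C \<theta> k)"
proof (rule dual_eqI)
  fix Y
  have app_sum: "dual_apply (sum f A) Z = (\<Sum>i\<in>A. dual_apply (f i) Z)" for f :: "nat \<Rightarrow> 'a dual" and A Z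
    by (induction A rule: infinite_finite_induct) (simp_all add: dual_apply_simps)
  have on_basis: "dual_apply \<beta> (X j) = dual_apply (\<Sum>k=1..N. dual_apply \<beta> (X k) *\<^sub>C \<theta> k) (X j)"
    if "j \<in> {1..N}" for j
  proof -
    have "dual_apply (\<Sum>k=1..N. dual_apply \<beta> (X k) *\<^sub>C \<theta> k) (X j)
        = (\<Sum>k=1..N. dual_apply \<beta> (X k) * (if k = j then 1 else 0))"
      using assms that unfolding dual_bases_def
      by (auto simp: app_sum dual_apply_simps intro!: sum.cong)
    also have "\<dots> = dual_apply \<beta> (X j)"
      using that by (simp add: sum.delta if_distrib cong: if_cong)
    finally show ?thesis by simp
  qed
  let ?S = "{Y. dual_apply \<beta> Y = dual_apply (\<Sum>k=1..N. dual_apply \<beta> (X k) *\<^sub>C \<theta> k) Y}"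
  have "cvec.subspace ?S"
    unfolding cvec.subspace_def
    by (auto simp: clinear_0[OF clinear_dual_apply] clinear_add[OF clinear_dual_apply]
        clinear_scale[OF clinear_dual_apply])
  moreover have "X ` {1..N} \<subseteq> ?S" using on_basis by blast
  ultimately have "cvec.span (X ` {1..N}) \<subseteq> ?S" by (rule cvec.span_minimal[rotated])
  then show "dual_apply \<beta> Y = dual_apply (\<Sum>k=1..N. dual_apply \<beta> (X k) *\<^sub>C \<theta> k) Y"
    using assms unfolding dual_bases_def is_basis_def by auto
qed

lemma coad_structure_constants:
  assumes "lie_algebra br" and db: "dual_bases N X \<theta>"
    and C: "\<And>j k. j \<in> {1..N} \<Longrightarrow> k \<in> {1..N} \<Longrightarrow> br (X j) (X k) = (\<Sum>t=1..N. C t j k *\<^sub>C X t)"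
    and j: "j \<in> {1..N}" and t: "t \<in> {1..N}"
  shows "coad br (X j) (\<theta> t) = - (\<Sum>k=1..N. C t j k *\<^sub>C \<theta> k)"
proof -
  have "dual_apply (coad br (X j) (\<theta> t)) (X k) = - C t j k" if k: "k \<in> {1..N}" for k
  proof -
    have "dual_apply (\<theta> t) (br (X j) (X k)) = (\<Sum>s=1..N. C s j k * dual_apply (\<theta> t) (X s))"
      by (simp add: C[OF j k] clinear_sum[OF clinear_dual_apply]
          clinear_scale[OF clinear_dual_apply] scaleC_complex_def)
    also have "\<dots> = (\<Sum>s=1..N. C s j k * (if t = s then 1 else 0))"
      using db t unfolding dual_bases_def by (intro sum.cong) auto
    also have "\<dots> = C t j k"
      using t by (simp add: sum.delta' if_distrib cong: if_cong)
    finally show ?thesis by (simp add: dual_apply_coad[OF assms(1)])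
  qed
  then show ?thesis
    by (subst dual_basis_expansion[OF db]) (simp add: sum_negf)
qed


section \<open>Stable modules over the semidirect product\<close>

definition stable_semidirect_module ::
  "('g::complex_vector \<Rightarrow> 'g \<Rightarrow> 'g) \<Rightarrow> nat \<Rightarrow> (nat \<Rightarrow> 'g) \<Rightarrow> (nat \<Rightarrow> 'g dual) \<Rightarrow>
    ('v::complex_vector \<Rightarrow> 'g \<Rightarrow> 'v) \<Rightarrow> ('v \<Rightarrow> 'g dual \<Rightarrow> 'v) \<Rightarrow> bool" where
  "stable_semidirect_module br N X \<theta> gact dact \<longleftrightarrow>
    right_lie_module (semidirect_br br) (\<lambda>v (\<alpha>, Y). dact v \<alpha> + gact v Y) \<and>
    (\<forall>v. (\<Sum>i=1..N. gact (dact v (\<theta> i)) (X i)) = 0)"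

end

theory Submission
  imports Defs
begin

text \<open>
  Dual bases identify a tensor \<open>t \<in> \<gg> \<otimes> V\<close> with its slices \<open>(\<alpha> \<otimes> id) t\<close>, because
  \<open>t = \<Sum>\<^sub>i X\<^sub>i \<otimes> (\<theta>\<^sup>i \<otimes> id) t\<close> (lemma \<open>tensor_slice_expansion\<close>); hence two tensors are equal as soon as
  all their slices are (lemma \<open>tensor_eq_iff_slice\<close>). By hypothesis the slices of the coaction are
  the operators \<open>v \<lhd> \<alpha>\<close>, so that the coaction is \<open>v \<mapsto> \<Sum>\<^sub>i X\<^sub>i \<otimes> (v \<lhd> \<theta>\<^sup>i)\<close> and the two
  stability conditions are literally the same equation.

  For the remaining conditions, slice the anti-Yetter-Drinfeld identity with \<open>\<beta> \<in> \<gg>\<^sup>*\<close>. Since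
  \<open>(X \<rhd> \<beta>)(Y) = \<beta> [Y, X]\<close>, it becomes \<open>(v \<cdot> X) \<lhd> \<beta> = (v \<lhd> \<beta>) \<cdot> X + v \<lhd> (X \<rhd> \<beta>)\<close>
  (lemma \<open>AYD_iff_slice\<close>). This is the module axiom for the semidirect product on a mixed pair of
  elements. On a pair from \<open>\<gg>\<close> the axiom says that \<open>V\<close> is a \<open>\<gg>\<close>-module, and on a pair from
  \<open>\<gg>\<^sup>*\<close> that the operators \<open>v \<lhd> \<alpha>\<close> commute, which holds since \<open>S(\<gg>\<^sup>*)\<close> is commutative;
  by bilinearity these cases suffice (lemma \<open>right_lie_module_semidirect_iff\<close>).
\<close>


section \<open>Slices of tensors\<close>

lemmas tensor_bilinear = cbilinear_tensor[unfolded cbilinear_iff, rule_format]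

lemma basis_expansion_by_dual:
  assumes "dual_bases N X \<theta>"
  shows "x = (\<Sum>i=1..N. dual_apply (\<theta> i) x *\<^sub>C X i)"
proof -
  let ?f = "\<lambda>x. \<Sum>i=1..N. dual_apply (\<theta> i) x *\<^sub>C X i"
  let ?S = "{x. x = ?f x}"
  have "clinear ?f"
    by (simp add: clinear_iff clinear_add[OF clinear_dual_apply] clinear_scale[OF clinear_dual_apply]
        scaleC_add_left sum.distrib cvec.scale_sum_right scaleC_complex_def)
  then have "cvec.subspace ?S"
    unfolding cvec.subspace_def using clinear_0[of ?f] clinear_add[of ?f] clinear_scale[of ?f]
    by simp
  moreover have "X j \<in> ?S" if "j \<in> {1..N}" for j
  proof -
    have "(\<Sum>i=1..N. dual_apply (\<theta> i) (X j) *\<^sub>C X i) = (\<Sum>i=1..N. if i = j then X i else 0)"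
      using assms that unfolding dual_bases_def by (intro sum.cong) (auto simp: scaleC_one)
    also have "\<dots> = X j"
      using that by simp
    finally show ?thesis by simp
  qed
  ultimately have "cvec.span (X ` {1..N}) \<subseteq> ?S"
    by (intro cvec.span_minimal) auto
  then show ?thesis
    using assms unfolding dual_bases_def is_basis_def by auto
qed

text \<open>The slice \<open>(\<alpha> \<otimes> id) t\<close>, which contracts the left tensor factor of \<open>t\<close> with a linear form \<open>\<alpha>\<close>.\<close>

definition tensor_slice ::
  "'g::complex_vector dual \<Rightarrow> ('g, 'v::complex_vector) tensor \<Rightarrow> 'v" where
  "tensor_slice \<alpha> = tensor_lift (\<lambda>y w. dual_apply \<alpha> y *\<^sub>C w)"

lemma cbilinear_slice: "cbilinear (\<lambda>y w. dual_apply \<alpha> y *\<^sub>C w)"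
  unfolding cbilinear_iff
  by (auto simp: clinear_add[OF clinear_dual_apply] clinear_scale[OF clinear_dual_apply]
      scaleC_add_left scaleC_add_right scaleC_complex_def scaleC_scaleC mult.commute)

lemma clinear_tensor_slice: "clinear (tensor_slice \<alpha>)"
  unfolding tensor_slice_def by (rule clinear_tensor_lift[OF cbilinear_slice])

lemma tensor_slice_tensor: "tensor_slice \<alpha> (y \<otimes> w) = dual_apply \<alpha> y *\<^sub>C w"
  unfolding tensor_slice_def by (rule tensor_lift_tensor[OF cbilinear_slice])

lemma tensor_slice_expansion:
  assumes "dual_bases N X \<theta>"
  shows "t = (\<Sum>i=1..N. X i \<otimes> tensor_slice (\<theta> i) t)"
proof (induction t rule: tensor_induct)
  case (add s t)
  have "(\<Sum>i=1..N. X i \<otimes> tensor_slice (\<theta> i) (s + t)) =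
      (\<Sum>i=1..N. X i \<otimes> tensor_slice (\<theta> i) s) + (\<Sum>i=1..N. X i \<otimes> tensor_slice (\<theta> i) t)"
    by (simp add: clinear_add[OF clinear_tensor_slice] tensor_bilinear sum.distrib)
  then show ?case
    using add by simp
next
  case (scale c t)
  have "(\<Sum>i=1..N. X i \<otimes> tensor_slice (\<theta> i) (c *\<^sub>C t)) =
      c *\<^sub>C (\<Sum>i=1..N. X i \<otimes> tensor_slice (\<theta> i) t)"
    by (simp add: clinear_scale[OF clinear_tensor_slice] tensor_bilinear cvec.scale_sum_right)
  then show ?case
    using scale by simp
next
  case (tensor x y)
  have lin: "clinear (\<lambda>x. x \<otimes> y)"
    using cbilinear_tensor unfolding cbilinear_def by blast
  have "x \<otimes> y = (\<Sum>i=1..N. dual_apply (\<theta> i) x *\<^sub>C X i) \<otimes> y"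
    by (rule arg_cong[OF basis_expansion_by_dual[OF assms]])
  also have "\<dots> = (\<Sum>i=1..N. X i \<otimes> tensor_slice (\<theta> i) (x \<otimes> y))"
    by (simp add: clinear_sum[OF lin] tensor_slice_tensor tensor_bilinear)
  finally show ?case .
qed

lemma tensor_eq_iff_slice:
  fixes s t :: "('g::complex_vector, 'v::complex_vector) tensor"
    and X :: "nat \<Rightarrow> 'g"
  assumes "dual_bases N X \<theta>"
  shows "s = t \<longleftrightarrow> (\<forall>\<alpha>. tensor_slice \<alpha> s = tensor_slice \<alpha> t)"
proof
  assume slices: "\<forall>\<alpha>. tensor_slice \<alpha> s = tensor_slice \<alpha> t"
  have "s = (\<Sum>i=1..N. X i \<otimes> tensor_slice (\<theta> i) s)"
    by (rule tensor_slice_expansion[OF assms])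
  also have "\<dots> = (\<Sum>i=1..N. X i \<otimes> tensor_slice (\<theta> i) t)"
    by (simp only: slices)
  also have "\<dots> = t"
    by (rule tensor_slice_expansion[OF assms, symmetric])
  finally show "s = t" .
qed simp

lemma tensor_lift_eq_sum_slices:
  assumes "dual_bases N X \<theta>" and B: "cbilinear B"
  shows "tensor_lift B t = (\<Sum>i=1..N. B (X i) (tensor_slice (\<theta> i) t))"
proof -
  have "tensor_lift B t = tensor_lift B (\<Sum>i=1..N. X i \<otimes> tensor_slice (\<theta> i) t)"
    by (rule arg_cong[OF tensor_slice_expansion[OF assms(1)]])
  then show ?thesis
    by (simp add: clinear_sum[OF clinear_tensor_lift[OF B]] tensor_lift_tensor[OF B])
qed


section \<open>The anti-Yetter-Drinfeld condition on slices\<close>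

lemma tensor_slice_act_right:
  assumes "clinear f"
  shows "tensor_slice \<beta> (tensor_lift (\<lambda>y w. y \<otimes> f w) t) = f (tensor_slice \<beta> t)"
proof -
  have B: "cbilinear (\<lambda>y w. y \<otimes> f w)"
    using assms by (simp add: tensor_bilinear cbilinear_iff clinear_iff)
  show ?thesis
    by (induction t rule: tensor_induct)
      (simp_all add: clinear_add[OF clinear_tensor_slice] clinear_scale[OF clinear_tensor_slice]
        clinear_add[OF clinear_tensor_lift[OF B]] clinear_scale[OF clinear_tensor_lift[OF B]]
        clinear_add[OF assms] clinear_scale[OF assms] tensor_lift_tensor[OF B] tensor_slice_tensor)
qed

text \<open>The coadjoint action of \<open>X\<close> is the transpose of \<open>y \<mapsto> [y, X]\<close>.\<close>

lemma tensor_slice_bracket_left: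
  assumes "lie_algebra br"
  shows "tensor_slice \<beta> (tensor_lift (\<lambda>y w. br y X \<otimes> w) t) = tensor_slice (coad br X \<beta>) t"
proof -
  have B: "cbilinear (\<lambda>y w. br y X \<otimes> w)"
    using assms by (simp add: tensor_bilinear cbilinear_iff lie_algebra_def)
  have coad: "dual_apply \<beta> (br y X) = dual_apply (coad br X \<beta>) y" for y
    by (simp add: dual_apply_coad[OF assms] lie_algebra_anticomm[OF assms, of y X]
        clinear_minus[OF clinear_dual_apply])
  show ?thesis
    by (induction t rule: tensor_induct)
      (simp_all add: clinear_add[OF clinear_tensor_slice] clinear_scale[OF clinear_tensor_slice]
        clinear_add[OF clinear_tensor_lift[OF B]] clinear_scale[OF clinear_tensor_lift[OF B]]
        tensor_lift_tensor[OF B] tensor_slice_tensor coad)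
qed

lemma AYD_iff_slice:
  fixes X :: "nat \<Rightarrow> 'g::complex_vector" and act :: "'v::complex_vector \<Rightarrow> 'g \<Rightarrow> 'v"
  assumes "lie_algebra br" and "dual_bases N X \<theta>" and "cbilinear act"
  shows "coact (act v Y) =
      tensor_lift (\<lambda>y w. y \<otimes> act w Y) (coact v) + tensor_lift (\<lambda>y w. br y Y \<otimes> w) (coact v)
    \<longleftrightarrow> (\<forall>\<beta>. tensor_slice \<beta> (coact (act v Y)) =
      act (tensor_slice \<beta> (coact v)) Y + tensor_slice (coad br Y \<beta>) (coact v))"
proof -
  have "clinear (\<lambda>w. act w Y)"
    using assms(3) unfolding cbilinear_def by blast
  then show ?thesis
    by (simp add: tensor_eq_iff_slice[OF assms(2)] clinear_add[OF clinear_tensor_slice]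
        tensor_slice_act_right tensor_slice_bracket_left[OF assms(1)])
qed


section \<open>Modules over the semidirect product\<close>

lemma coad_zero_left:
  assumes "lie_algebra br"
  shows "coad br 0 \<beta> = 0"
proof (rule dual_eqI)
  fix Y
  have "clinear (\<lambda>x. br x Y)"
    using assms unfolding lie_algebra_def cbilinear_def by blast
  then show "dual_apply (coad br 0 \<beta>) Y = dual_apply 0 Y"
    using clinear_0[of "\<lambda>x. br x Y"]
    by (simp add: dual_apply_coad[OF assms] dual_apply_simps clinear_0[OF clinear_dual_apply])
qed

lemma right_lie_module_semidirect_iff:
  assumes br: "lie_algebra br" and g: "right_lie_module br gact" and d: "cbilinear dact"
    and comm: "\<And>v \<alpha> \<beta>. dact (dact v \<alpha>) \<beta> = dact (dact v \<beta>) \<alpha>"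
  shows "right_lie_module (semidirect_br br) (\<lambda>v (\<alpha>, Y). dact v \<alpha> + gact v Y)
    \<longleftrightarrow> (\<forall>v Y \<beta>. dact (gact v Y) \<beta> = gact (dact v \<beta>) Y + dact v (coad br Y \<beta>))"
    (is "?L \<longleftrightarrow> ?R")
proof -
  have gb: "cbilinear gact"
    and gmod: "\<And>v Y Z. gact v (br Y Z) = gact (gact v Y) Z - gact (gact v Z) Y"
    using g unfolding right_lie_module_def by blast+
  note bil = gb[unfolded cbilinear_iff] d[unfolded cbilinear_iff]
  have zero: "gact v 0 = 0" "dact v 0 = 0" for v
    using gb d by (auto simp: cbilinear_def intro: clinear_0)
  have dminus: "dact v (\<alpha> - \<beta>) = dact v \<alpha> - dact v \<beta>" for v \<alpha> \<beta>
    using d by (auto simp: cbilinear_def intro: clinear_diff)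
  have brz: "br Y 0 = 0" for Y
    using br by (auto simp: lie_algebra_def cbilinear_def intro: clinear_0)
  show ?thesis
  proof
    assume L: ?L
    show ?R
    proof (intro allI)
      fix v Y \<beta>
      \<comment> \<open>The module axiom on the mixed pair \<open>0 \<oplus> Y\<close>, \<open>\<beta> \<oplus> 0\<close>.\<close>
      have "(\<lambda>v (\<alpha>, Y). dact v \<alpha> + gact v Y) v (semidirect_br br (0, Y) (\<beta>, 0)) =
        dact (gact v Y) \<beta> - gact (dact v \<beta>) Y"
        using L unfolding right_lie_module_def by (simp add: zero)
      then show "dact (gact v Y) \<beta> = gact (dact v \<beta>) Y + dact v (coad br Y \<beta>)"
        by (simp add: semidirect_br_def coad_zero_left[OF br] brz zero algebra_simps)
    qed
  next
    assume R: ?R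
    have "cbilinear (\<lambda>v (\<alpha>, Y). dact v \<alpha> + gact v Y)"
      using bil unfolding cbilinear_iff
      by (auto simp: scaleC_prod_def scaleC_add_right algebra_simps)
    moreover have "(\<lambda>v (\<alpha>, Y). dact v \<alpha> + gact v Y) v (semidirect_br br (\<alpha>, Y) (\<beta>, Z)) =
        dact (dact v \<alpha> + gact v Y) \<beta> + gact (dact v \<alpha> + gact v Y) Z
        - (dact (dact v \<beta> + gact v Z) \<alpha> + gact (dact v \<beta> + gact v Z) Y)" for v \<alpha> Y \<beta> Z
      using bil R comm[of v \<alpha> \<beta>] by (simp add: semidirect_br_def dminus gmod)
    ultimately show ?L
      unfolding right_lie_module_def by (simp add: split_paired_all)
  qed
qed


section \<open>Stable modules and SAYD modules\<close>

theorem proposition5p13: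
  fixes br :: "'g::complex_vector \<Rightarrow> 'g \<Rightarrow> 'g"
    and N :: nat and X :: "nat \<Rightarrow> 'g" and \<theta> :: "nat \<Rightarrow> 'g dual"
    and gact :: "'v::complex_vector \<Rightarrow> 'g \<Rightarrow> 'v"
    and sact :: "'v \<Rightarrow> 'g dual sym_alg \<Rightarrow> 'v"
    and coact :: "'v \<Rightarrow> ('g, 'v) tensor"
  assumes "lie_algebra br"
    and "dual_bases N X \<theta>"
    and "right_lie_module br gact"
    and "right_sym_module sact"
    and "left_lie_coaction coact"
    and "\<And>v \<alpha>. sact v (sym_incl \<alpha>) = tensor_lift (\<lambda>y w. dual_apply \<alpha> y *\<^sub>C w) (coact v)"
  shows "stable_semidirect_module br N X \<theta> gact (\<lambda>v \<alpha>. sact v (sym_incl \<alpha>))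
    \<longleftrightarrow> right_left_SAYD br gact coact"
proof -
  define dact where "dact = (\<lambda>v \<alpha>. sact v (sym_incl \<alpha>))"
  have slice: "tensor_slice \<alpha> (coact v) = dact v \<alpha>" for v \<alpha>
    by (simp add: dact_def tensor_slice_def assms(6))
  have gb: "cbilinear gact"
    using assms(3) unfolding right_lie_module_def by blast
  have db: "cbilinear dact"
    using assms(4) unfolding right_sym_module_def cbilinear_iff dact_def
    by (simp add: clinear_add[OF clinear_sym_incl] clinear_scale[OF clinear_sym_incl])
  have comm: "dact (dact v \<alpha>) \<beta> = dact (dact v \<beta>) \<alpha>" for v \<alpha> \<beta>
    using assms(4) unfolding right_sym_module_def dact_def by (metis mult.commute)
  have "cbilinear (\<lambda>y w. gact w y)"
    using gb unfolding cbilinear_def by blast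
  then have stable: "tensor_lift (\<lambda>y w. gact w y) (coact v) = (\<Sum>i=1..N. gact (dact v (\<theta> i)) (X i))" for v
    by (simp add: tensor_lift_eq_sum_slices[OF assms(2)] slice)
  have "stable_semidirect_module br N X \<theta> gact dact \<longleftrightarrow> right_left_SAYD br gact coact"
    unfolding stable_semidirect_module_def right_left_SAYD_def
      right_lie_module_semidirect_iff[OF assms(1,3) db comm] AYD_iff_slice[OF assms(1,2) gb]
      slice stable
    using assms(3,5) by blast
  then show ?thesis
    by (simp add: dact_def)
qed

end
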